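(* Consider a Stackelberg game without contexts with finite leader action set $\mathcal{A}$, finite follower action set $\mathcal{A}_f$ and follower types $[K]$, and let $\mathcal{P} = \{u_{\mathbf{x}} : \mathbf{x} \in \Delta(\mathcal{A})\}$ be the class of leader payoff functions $u_{\mathbf{x}} : [K] \to \mathbb{R}$, $u_{\mathbf{x}}(f) = u(\mathbf{x}, b_f(\mathbf{x}))$. Then $$\mathrm{Pdim}(\mathcal{P}) \le 9 |\mathcal{A}| \log\left( 4 |\mathcal{A}|\, |\mathcal{A}_f|^2 \right),$$ where $\log$ is the base-2 logarithm.
   Context: Stackelberg game without contexts. $\mathcal{A}$ and $\mathcal{A}_f$ are finite nonempty action sets of the leader and the follower; the leader's utility is $u : \mathcal{A} \times \mathcal{A}_f \to [0,1]$ and a follower of type $f \in [K]$ has utility $u_f : \mathcal{A} \times \mathcal{A}_f \to [0,1]$. For a mixed strategy $\mathbf{x} \in \Delta(\mathcal{A})$ (probability simplex over $\mathcal{A}$), $u(\mathbf{x}, a_f) = \sum_{a_l \in \mathcal{A}} \mathbf{x}[a_l]\, u(a_l, a_f)$, and the best response of type $f$ is $b_f(\mathbf{x}) \in \arg\max_{a_f \in \mathcal{A}_f} \sum_{a_l \in \mathcal{A}} \mathbf{x}[a_l]\, u_f(a_l, a_f)$, ties being broken by a fixed deterministic order on $\mathcal{A}_f$. Pseudo-dimension. Let $\mathcal{F}$ be a class of functions $A \to \mathbb{R}$ on an abstract domain $A$. Numbers $y^{(1)}, \ldots, y^{(n)} \in \mathbb{R}$ witness the shattering of $S = \{x^{(1)},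 \ldots, x^{(n)}\} \subseteq A$ if for all $T \subseteq S$ there is $f_T \in \mathcal{F}$ such that $f_T(x^{(i)}) \le y^{(i)}$ for all $x^{(i)} \in T$ and $f_T(x^{(i)}) > y^{(i)}$ for all $x^{(i)} \notin T$. $\mathrm{Pdim}(\mathcal{F})$ is the size of the largest set that can be shattered by $\mathcal{F}$ (i.e. whose shattering has a witness). *)

theory Defs
  imports Complex_Main "HOL-Library.Extended_Nat" "HOL-Library.Extended_Real"
begin

definition mixed_strategies :: "'a set \<Rightarrow> ('a \<Rightarrow> real) set" where
  "mixed_strategies A =
     {x. (\<forall>a\<in>A. 0 \<le> x a) \<and> (\<forall>a. a \<notin> A \<longrightarrow> x a = 0) \<and> (\<Sum>a\<in>A. x a) = 1}"

definition expected_utility ::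
  "'a set \<Rightarrow> ('a \<Rightarrow> 'b \<Rightarrow> real) \<Rightarrow> ('a \<Rightarrow> real) \<Rightarrow> 'b \<Rightarrow> real" where
  "expected_utility A v x b = (\<Sum>a\<in>A. x a * v a b)"

definition optimal_responses ::
  "'a set \<Rightarrow> 'b set \<Rightarrow> ('a \<Rightarrow> 'b \<Rightarrow> real) \<Rightarrow> ('a \<Rightarrow> real) \<Rightarrow> 'b set" where
  "optimal_responses A Af v x =
     {b. is_arg_max (expected_utility A v x) (\<lambda>b. b \<in> Af) b}"

text \<open>The linear order r on Af is the tie-breaking order: among the optimal responses,
  the r-first one is played.  If Af is finite and nonempty, this response exists and is
  unique.\<close>

definition best_response ::
  "'a set \<Rightarrow> 'b set \<Rightarrow> 'b rel \<Rightarrow> ('a \<Rightarrow> 'b \<Rightarrow> real) \<Rightarrow> ('a \<Rightarrow> real) \<Rightarrow> 'b" where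
  "best_response A Af r v x =
     (THE b. b \<in> optimal_responses A Af v x \<and>
             (\<forall>b'\<in>optimal_responses A Af v x. (b, b') \<in> r))"

text \<open>Here v t is the utility function of the follower of type t.\<close>

definition leader_payoff ::
  "'a set \<Rightarrow> 'b set \<Rightarrow> 'b rel \<Rightarrow> ('a \<Rightarrow> 'b \<Rightarrow> real) \<Rightarrow> ('t \<Rightarrow> 'a \<Rightarrow> 'b \<Rightarrow> real) \<Rightarrow>
     ('a \<Rightarrow> real) \<Rightarrow> 't \<Rightarrow> real" where
  "leader_payoff A Af r u v x t = expected_utility A u x (best_response A Af r (v t) x)"

definition leader_payoffs ::
  "'a set \<Rightarrow> 'b set \<Rightarrow> 'b rel \<Rightarrow> ('a \<Rightarrow> 'b \<Rightarrow> real) \<Rightarrow> ('t \<Rightarrow> 'a \<Rightarrow> 'b \<Rightarrow> real) \<Rightarrow>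
     ('t \<Rightarrow> real) set" where
  "leader_payoffs A Af r u v = leader_payoff A Af r u v ` mixed_strategies A"

definition witnesses_shattering ::
  "('x \<Rightarrow> real) set \<Rightarrow> 'x set \<Rightarrow> ('x \<Rightarrow> real) \<Rightarrow> bool" where
  "witnesses_shattering F S y \<longleftrightarrow>
     (\<forall>T\<subseteq>S. \<exists>f\<in>F. (\<forall>s\<in>T. f s \<le> y s) \<and> (\<forall>s\<in>S - T. f s > y s))"

definition shattered :: "('x \<Rightarrow> real) set \<Rightarrow> 'x set \<Rightarrow> bool" where
  "shattered F S \<longleftrightarrow> (\<exists>y. witnesses_shattering F S y)"

text \<open>The pseudo-dimension of a class of functions on the domain D, where only the values
  on D matter.  It is infinite if there are arbitrarily large finite shattered sets.\<close>

definition pdim :: "'x set \<Rightarrow> ('x \<Rightarrow> real) set \<Rightarrow> enat" where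
  "pdim D F = (SUP S\<in>{S. S \<subseteq> D \<and> finite S \<and> shattered F S}. enat (card S))"

end

theory Submission
  imports Defs
begin

text \<open>
  Fix a set of \<open>N\<close> types shattered with thresholds \<open>y\<close>. On the simplex a threshold test
  \<open>\<langle>x, w\<rangle> \<le> c\<close> is the homogeneous linear test \<open>\<langle>x, c - w\<rangle> \<ge> 0\<close>, so the dichotomy induced by a mixed
  strategy is determined by the signs of \<open>2 N |Af|\<^sup>2\<close> linear forms on \<open>|A|\<close>-dimensional
  space: the pairwise comparisons of follower actions determine the best responses, and the
  comparisons of the leader's payoffs with \<open>y\<close> do the rest. Linear forms shatter at most \<open>|A|\<close>
  points, so the Sauer--Shelah lemma yields \<open>2 ^ N \<le> (2 N |Af|\<^sup>2 + 1) ^ |A|\<close>, and it remains to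
  solve for \<open>N\<close>.
\<close>

section \<open>Set families: the Sauer--Shelah lemma\<close>

definition shattered_subsets :: "'i set set \<Rightarrow> 'i set \<Rightarrow> 'i set set" where
  "shattered_subsets F I = {X. X \<subseteq> I \<and> (\<forall>Y\<subseteq>X. \<exists>Z\<in>F. Z \<inter> X = Y)}"

lemma shattered_subsetsI:
  "X \<subseteq> I \<Longrightarrow> (\<And>Y. Y \<subseteq> X \<Longrightarrow> \<exists>Z\<in>F. Z \<inter> X = Y) \<Longrightarrow> X \<in> shattered_subsets F I"
  by (simp add: shattered_subsets_def)

lemma shattered_subsetsD:
  assumes "X \<in> shattered_subsets F I"
  shows "X \<subseteq> I" and "Y \<subseteq> X \<Longrightarrow> \<exists>Z\<in>F. Z \<inter> X = Y"
  using assms by (simp_all add: shattered_subsets_def)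

text \<open>Pajor's form of the Sauer--Shelah lemma.\<close>

lemma card_le_card_shattered_subsets:
  assumes "finite I" "F \<subseteq> Pow I"
  shows "card F \<le> card (shattered_subsets F I)"
  using assms
proof (induction I arbitrary: F rule: finite_induct)
  case empty
  then consider "F = {}" | "F = {{}}" by (auto simp: subset_singleton_iff)
  then show ?case
  proof cases
    case 2
    then have "shattered_subsets F {} = {{}}" by (auto simp: shattered_subsets_def)
    then show ?thesis using 2 by simp
  qed simp
next
  case (insert i I)
  \<comment> \<open>The members of \<open>F\<close> are split by whether they contain
    \<open>i\<close>. Removing \<open>i\<close> is injective on those that do, so
    \<open>card F = card F0 + card F1\<close>, and both families live on \<open>I\<close>, where the
    induction hypothesis applies.\<close>
  define F0 where "F0 = {Z \<in> F. i \<notin> Z}"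
  define F1 where "F1 = (\<lambda>Z. Z - {i}) ` {Z \<in> F. i \<in> Z}"
  let ?S0 = "shattered_subsets F0 I" and ?S1 = "shattered_subsets F1 I"
  have finF: "finite F"
    using insert.prems insert.hyps by (meson finite_Pow_iff finite_insert finite_subset)
  have fin: "finite ?S0" "finite ?S1"
    using insert.hyps by (auto simp: shattered_subsets_def)
  have notin: "i \<notin> X" if "X \<in> ?S0 \<union> ?S1" for X
    using that insert.hyps by (auto simp: shattered_subsets_def)
  have "card F = card F0 + card {Z \<in> F. i \<in> Z}"
    unfolding F0_def using finF
    by (subst card_Un_disjoint[symmetric]) (auto intro: arg_cong[where f = card])
  also have "card {Z \<in> F. i \<in> Z} = card F1"
    unfolding F1_def by (rule card_image[symmetric]) (auto simp: inj_on_def)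
  also have "card F0 + card F1 \<le> card ?S0 + card ?S1"
    using insert.prems by (intro add_mono insert.IH) (auto simp: F0_def F1_def)
  also have "\<dots> = card (?S0 \<union> ?S1) + card (?S0 \<inter> ?S1)"
    using card_Un_Int[OF fin] .
  \<comment> \<open>A set \<open>X\<close> shattered by both families is counted twice. The second
    count is charged to \<open>insert i X\<close>, which \<open>F\<close> shatters:
    \<open>F1\<close> supplies the traces containing \<open>i\<close> and \<open>F0\<close> those
    without it. As \<open>i\<close> lies in no member of \<open>?S0\<close> or \<open>?S1\<close>,
    nothing is charged twice.\<close>
  also have "card (?S0 \<inter> ?S1) = card (insert i ` (?S0 \<inter> ?S1))"
    using notin by (intro card_image[symmetric]) (auto simp: inj_on_def insert_eq_iff)
  also have "card (?S0 \<union> ?S1) + \<dots> = card ((?S0 \<union> ?S1) \<union> insert i ` (?S0 \<inter> ?S1))"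
    using notin fin by (intro card_Un_disjoint[symmetric]) auto
  also have "\<dots> \<le> card (shattered_subsets F (insert i I))"
  proof (rule card_mono)
    show "finite (shattered_subsets F (insert i I))"
      using insert.hyps by (auto simp: shattered_subsets_def)
    have 0: "X \<in> shattered_subsets F (insert i I)" if "X \<in> ?S0" for X
      using that unfolding shattered_subsets_def F0_def by blast
    have 1: "X \<in> shattered_subsets F (insert i I)" if X: "X \<in> ?S1" for X
    proof -
      have "\<exists>Z\<in>F. Z \<inter> X = Y" if Y: "Y \<subseteq> X" for Y
      proof -
        obtain Z where "Z \<in> F" "(Z - {i}) \<inter> X = Y"
          using shattered_subsetsD(2)[OF X Y] by (auto simp: F1_def)
        moreover have "i \<notin> X" using notin X by blast
        ultimately show ?thesis by blast
      qed
      then show ?thesis using shattered_subsetsD(1)[OF X] by (intro shattered_subsetsI) auto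
    qed
    have 2: "insert i X \<in> shattered_subsets F (insert i I)" if X: "X \<in> ?S0" "X \<in> ?S1" for X
    proof -
      have i: "i \<notin> X" using notin X by blast
      have "\<exists>Z\<in>F. Z \<inter> insert i X = Y" if Y: "Y \<subseteq> insert i X" for Y
      proof (cases "i \<in> Y")
        case True
        have "Y - {i} \<subseteq> X" using Y by blast
        then obtain W where "W \<in> F1" "W \<inter> X = Y - {i}"
          using shattered_subsetsD(2)[OF X(2)] by blast
        moreover from this obtain Z where "Z \<in> F" "i \<in> Z" "W = Z - {i}"
          unfolding F1_def by blast
        ultimately have "Z \<inter> insert i X = Y" using True i by blast
        then show ?thesis using \<open>Z \<in> F\<close> by blast
      next
        case False
        then have "Y \<subseteq> X" using Y by blast
        then obtain Z where "Z \<in> F0" "Z \<inter> X = Y"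
          using shattered_subsetsD(2)[OF X(1)] by blast
        moreover from this have "Z \<in> F" "i \<notin> Z" by (auto simp: F0_def)
        ultimately show ?thesis by auto
      qed
      then show ?thesis using shattered_subsetsD(1)[OF X(1)] by (intro shattered_subsetsI) auto
    qed
    show "(?S0 \<union> ?S1) \<union> insert i ` (?S0 \<inter> ?S1) \<subseteq> shattered_subsets F (insert i I)"
      using 0 1 2 by blast
  qed
  finally show ?case .
qed

text \<open>A crude substitute for the sum of binomial coefficients. A set with at most
  \<open>d + 1\<close> elements either has at most \<open>d\<close> or arises from such a set by
  inserting one of \<open>card I\<close> elements, so each step costs a factor
  \<open>card I + 1\<close>.\<close>

lemma card_subsets_card_le:
  assumes "finite I"
  shows "card {X. X \<subseteq> I \<and> card X \<le> d} \<le> (card I + 1) ^ d"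
proof (induction d)
  case 0
  have "{X. X \<subseteq> I \<and> card X \<le> 0} = {{}}"
    using assms finite_subset by fastforce
  then show ?case by simp
next
  case (Suc d)
  let ?S = "\<lambda>d. {X. X \<subseteq> I \<and> card X \<le> d}"
  have fin: "finite (?S d)" using assms by simp
  have "?S (Suc d) \<subseteq> ?S d \<union> (\<lambda>(i, X). insert i X) ` (I \<times> ?S d)"
  proof
    fix X assume X: "X \<in> ?S (Suc d)"
    show "X \<in> ?S d \<union> (\<lambda>(i, X). insert i X) ` (I \<times> ?S d)"
    proof (cases "card X \<le> d")
      case False
      then obtain i where i: "i \<in> X" by fastforce
      have "card (X - {i}) \<le> d" using X i by (auto simp: card_Diff_singleton)
      then have "(i, X - {i}) \<in> I \<times> ?S d" using X i by blast
      moreover have "X = (\<lambda>(i, X). insert i X) (i, X - {i})" using i by (simp add: insert_absorb)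
      ultimately show ?thesis by (intro UnI2 image_eqI)
    qed (use X in auto)
  qed
  then have "card (?S (Suc d)) \<le> card (?S d \<union> (\<lambda>(i, X). insert i X) ` (I \<times> ?S d))"
    using fin assms by (intro card_mono) auto
  also have "\<dots> \<le> card (?S d) + card ((\<lambda>(i, X). insert i X) ` (I \<times> ?S d))"
    by (rule card_Un_le)
  also have "\<dots> \<le> card (?S d) + card (I \<times> ?S d)"
    using fin assms by (intro add_left_mono card_image_le) auto
  also have "\<dots> = (card I + 1) * card (?S d)"
    by (simp add: card_cartesian_product)
  also have "\<dots> \<le> (card I + 1) ^ Suc d"
    using Suc.IH by (simp only: power_Suc mult_le_mono2)
  finally show ?case .
qed

section \<open>Sign patterns of linear forms\<close>

text \<open>More vectors than coordinates are linearly dependent, by Gaussian elimination of one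
  coordinate at a time. The vectors form an indexed family, so equal vectors at different indices
  are allowed.\<close>

lemma nontrivial_linear_relation:
  fixes w :: "'i \<Rightarrow> 'a \<Rightarrow> 'f::field"
  assumes "finite A" "finite I" "card A < card I"
  shows "\<exists>c. (\<exists>i\<in>I. c i \<noteq> 0) \<and> (\<forall>a\<in>A. (\<Sum>i\<in>I. c i * w i a) = 0)"
  using assms
proof (induction A arbitrary: I w rule: finite_induct)
  case empty
  then have "I \<noteq> {}" by auto
  then show ?case by (intro exI[of _ "\<lambda>_. 1"]) auto
next
  case (insert a A)
  show ?case
  proof (cases "\<forall>i\<in>I. w i a = 0")
    case True
    have "card A < card I" using insert by simp
    then obtain c where "\<exists>i\<in>I. c i \<noteq> 0" "\<forall>a\<in>A. (\<Sum>i\<in>I. c i * w i a) = 0"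
      using insert.IH[OF insert.prems(1)] by blast
    then show ?thesis using True by (intro exI[of _ c]) auto
  next
    case False
    then obtain j where j: "j \<in> I" "w j a \<noteq> 0" by blast
    \<comment> \<open>With \<open>j\<close> as pivot, the vectors
      \<open>w i - (w i a / w j a) * w j\<close> vanish at \<open>a\<close>, so a relation on the
      coordinates in \<open>A\<close> is enough for them.\<close>
    have "card A < card (I - {j})" using insert j by simp
    then obtain c where c: "\<exists>i\<in>I - {j}. c i \<noteq> 0"
      and rel: "\<forall>b\<in>A. (\<Sum>i\<in>I - {j}. c i * (w i b - w i a / w j a * w j b)) = 0"
      using insert.IH[of "I - {j}" "\<lambda>i b. w i b - w i a / w j a * w j b"] insert.prems(1)
      by auto
    define s where "s = (\<Sum>i\<in>I - {j}. c i * w i a)"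
    \<comment> \<open>The coefficient of \<open>j\<close> collects all multiples of
      \<open>w j\<close> subtracted in the elimination. It cancels coordinate \<open>a\<close> and
      turns the relation between the reduced vectors into one between the original ones.\<close>
    define c' where "c' = c(j := - s / w j a)"
    have split: "(\<Sum>i\<in>I. c' i * w i b) = - s / w j a * w j b + (\<Sum>i\<in>I - {j}. c i * w i b)" for b
      using j insert.prems(1) by (simp add: sum.remove c'_def)
    have "(\<Sum>i\<in>I. c' i * w i b) = 0" if b: "b \<in> insert a A" for b
    proof (cases "b = a")
      case True
      then show ?thesis using split[of a] j by (simp add: s_def)
    next
      case False
      then have "0 = (\<Sum>i\<in>I - {j}. c i * (w i b - w i a / w j a * w j b))"
        using b rel by simp
      also have "\<dots> = (\<Sum>i\<in>I - {j}. c i * w i b) - s / w j a * w j b"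
        unfolding s_def sum_divide_distrib sum_distrib_right sum_subtractf[symmetric]
        by (intro sum.cong) (auto simp: algebra_simps)
      finally show ?thesis using split[of b] by simp
    qed
    moreover have "\<exists>i\<in>I. c' i \<noteq> 0" using c by (auto simp: c'_def)
    ultimately show ?thesis by blast
  qed
qed

text \<open>The sign pattern of \<open>x\<close> is encoded as a set of indices, so that the
  patterns of all \<open>x\<close> in a domain form a set family to which the Sauer--Shelah lemma
  applies.\<close>

definition nonneg_indices :: "'a set \<Rightarrow> ('i \<Rightarrow> 'a \<Rightarrow> real) \<Rightarrow> 'i set \<Rightarrow> ('a \<Rightarrow> real) \<Rightarrow> 'i set" where
  "nonneg_indices A w I x = {i \<in> I. 0 \<le> (\<Sum>a\<in>A. x a * w i a)}"

text \<open>Otherwise the forms indexed by \<open>X\<close> satisfy a nontrivial linear relation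
  \<open>c\<close>. Shattering provides an \<open>x\<close> at which exactly the forms with
  \<open>0 \<le> c i\<close> are nonnegative. Weighted by \<open>c\<close>, the values at
  \<open>x\<close> then have a positive sum, although the relation makes this sum zero.\<close>

lemma card_shattered_by_halfspaces:
  fixes w :: "'i \<Rightarrow> 'a \<Rightarrow> real"
  assumes "finite A" "finite I" and X: "X \<in> shattered_subsets (nonneg_indices A w I ` D) I"
  shows "card X \<le> card A"
proof (rule ccontr)
  assume "\<not> card X \<le> card A"
  have XI: "X \<subseteq> I" and finX: "finite X"
    using X assms(2) finite_subset by (auto simp: shattered_subsets_def)
  obtain c where c: "\<exists>i\<in>X. c i \<noteq> 0" and rel: "\<forall>a\<in>A. (\<Sum>i\<in>X. c i * w i a) = 0"
    using nontrivial_linear_relation[OF assms(1) finX, of w] \<open>\<not> card X \<le> card A\<close> by auto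
  \<comment> \<open>A negative coefficient is required for strictness: where
    \<open>0 \<le> c i\<close> the form may vanish at \<open>x\<close>, while where
    \<open>c i < 0\<close> its value is negative and the product positive. Negating the relation
    provides one if necessary.\<close>
  have "\<exists>c. (\<exists>i\<in>X. c i < 0) \<and> (\<forall>a\<in>A. (\<Sum>i\<in>X. c i * w i a) = 0)"
  proof (cases "\<exists>i\<in>X. c i < 0")
    case False
    then have "\<exists>i\<in>X. - c i < 0" using c by force
    then show ?thesis using rel by (intro exI[of _ "\<lambda>i. - c i"]) (auto simp: sum_negf)
  qed (use rel in blast)
  then obtain c j where j: "j \<in> X" "c j < 0" and rel: "\<forall>a\<in>A. (\<Sum>i\<in>X. c i * w i a) = 0"
    by blast
  have "{i \<in> X. 0 \<le> c i} \<subseteq> X" by blast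
  then obtain x where x: "nonneg_indices A w I x \<inter> X = {i \<in> X. 0 \<le> c i}"
    using X unfolding shattered_subsets_def by blast
  let ?g = "\<lambda>i. \<Sum>a\<in>A. x a * w i a"
  have sgn: "0 \<le> ?g i \<longleftrightarrow> 0 \<le> c i" if "i \<in> X" for i
    using x that XI by (auto simp: nonneg_indices_def set_eq_iff)
  have "0 < (\<Sum>i\<in>X. c i * ?g i)"
  proof (rule sum_pos2[OF finX j(1)])
    show "0 < c j * ?g j" using sgn[OF j(1)] j(2) by (intro mult_neg_neg) auto
    show "0 \<le> c i * ?g i" if "i \<in> X" for i
      using sgn[OF that] by (cases "0 \<le> c i") (auto intro: mult_nonneg_nonneg mult_nonpos_nonpos)
  qed
  also have "(\<Sum>i\<in>X. c i * ?g i) = (\<Sum>a\<in>A. x a * (\<Sum>i\<in>X. c i * w i a))"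
    unfolding sum_distrib_left by (subst sum.swap) (simp add: mult_ac)
  also have "\<dots> = 0" using rel by simp
  finally show False by simp
qed

lemma card_halfspace_patterns:
  fixes w :: "'i \<Rightarrow> 'a \<Rightarrow> real"
  assumes "finite A" "finite I"
  shows "card (nonneg_indices A w I ` D) \<le> (card I + 1) ^ card A"
proof -
  let ?F = "nonneg_indices A w I ` D"
  have "card ?F \<le> card (shattered_subsets ?F I)"
    using assms(2) by (rule card_le_card_shattered_subsets) (auto simp: nonneg_indices_def)
  also have "\<dots> \<le> card {X. X \<subseteq> I \<and> card X \<le> card A}"
    using card_shattered_by_halfspaces[OF assms] assms(2)
    by (intro card_mono) (auto simp: shattered_subsets_def)
  also have "\<dots> \<le> (card I + 1) ^ card A"
    using card_subsets_card_le[OF assms(2)] .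
  finally show ?thesis .
qed

section \<open>Best responses and the dichotomies of shattered types\<close>

lemma finite_linear_order_least:
  assumes "linear_order_on C r" "finite B" "B \<noteq> {}" "B \<subseteq> C"
  shows "\<exists>b\<in>B. \<forall>b'\<in>B. (b, b') \<in> r"
  using assms(2-4)
proof (induction B rule: finite_ne_induct)
  case (singleton b)
  then show ?case
    using assms(1) by (auto simp: order_on_defs refl_on_def)
next
  case (insert c B)
  then obtain b where b: "b \<in> B" "\<forall>b'\<in>B. (b, b') \<in> r" by blast
  have "c \<in> C" "b \<in> C" using insert.prems b(1) by auto
  then have "(c, c) \<in> r" "(b, c) \<in> r \<or> (c, b) \<in> r"
    using assms(1) by (auto simp: order_on_defs refl_on_def total_on_def) metis
  moreover have "trans r" using assms(1) by (auto simp: order_on_defs)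
  ultimately show ?case using b by (metis insert_iff transD)
qed

text \<open>The description by \<open>THE\<close> denotes an action because a maximum exists on the
  finite nonempty \<open>Af\<close> and antisymmetry of \<open>r\<close> makes the first maximizer
  unique. Membership in \<open>Af\<close> matters because the threshold tests are indexed by actions
  in \<open>Af\<close>.\<close>

lemma best_response_in_actions:
  assumes "finite Af" "Af \<noteq> {}" "linear_order_on Af r"
  shows "best_response A Af r v x \<in> Af"
proof -
  let ?O = "optimal_responses A Af v x"
  have sub: "?O \<subseteq> Af" by (auto simp: optimal_responses_def is_arg_max_def)
  have "Max (expected_utility A v x ` Af) \<in> expected_utility A v x ` Af"
    using assms by (intro Max_in) auto
  then obtain b0 where "b0 \<in> Af" "expected_utility A v x b0 = Max (expected_utility A v x ` Af)"
    by force
  then have "b0 \<in> ?O"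
    using assms(1) by (auto simp: optimal_responses_def is_arg_max_def not_less)
  then obtain b where b: "b \<in> ?O" "\<forall>b'\<in>?O. (b, b') \<in> r"
    using finite_linear_order_least[OF assms(3) finite_subset[OF sub assms(1)] _ sub] by blast
  have "antisym r" using assms(3) by (auto simp: order_on_defs)
  then have "best_response A Af r v x = b"
    unfolding best_response_def using b by (intro the_equality) (auto dest: antisymD)
  then show ?thesis using b sub by blast
qed

lemma optimal_responses_conv:
  "optimal_responses A Af v x =
     {b \<in> Af. \<forall>b'\<in>Af. 0 \<le> (\<Sum>a\<in>A. x a * (v a b - v a b'))}"
  by (auto simp: optimal_responses_def is_arg_max_def expected_utility_def not_less
        right_diff_distrib sum_subtractf)

lemma two_power_card_shattered_le:
  fixes u :: "'a \<Rightarrow> 'b \<Rightarrow> real"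
  assumes "finite A" "finite Af" "Af \<noteq> {}" "linear_order_on Af r" "finite S"
    and sh: "shattered (leader_payoffs A Af r u v) S"
  shows "2 ^ card S \<le> (2 * card S * (card Af)\<^sup>2 + 1) ^ card A"
proof -
  obtain y where y: "witnesses_shattering (leader_payoffs A Af r u v) S y"
    using sh by (auto simp: shattered_def)
  \<comment> \<open>The flag \<open>q\<close> separates the follower's comparison of
    \<open>b\<close> with \<open>b'\<close> from the threshold test for \<open>b\<close>. The
    threshold forms are repeated over \<open>b'\<close>, which keeps the index set a plain
    product.\<close>
  define I where "I = S \<times> Af \<times> Af \<times> (UNIV :: bool set)"
  define w where "w = (\<lambda>(t, b, b', q) a. if q then y t - u a b else v t a b - v t a b')"
  define P where "P = nonneg_indices A w I"
  define below where "below x = {t \<in> S. leader_payoff A Af r u v x t \<le> y t}" for x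
  let ?D = "mixed_strategies A"
  have finI: "finite I" using assms by (simp add: I_def)
  have finP: "finite (P ` ?D)"
    by (rule finite_subset[of _ "Pow I"]) (use finI in \<open>auto simp: P_def nonneg_indices_def\<close>)
  have cardI: "card I = 2 * card S * (card Af)\<^sup>2"
    by (simp add: I_def card_cartesian_product power2_eq_square)
  have compare: "b \<in> Af \<Longrightarrow> b' \<in> Af \<Longrightarrow> t \<in> S \<Longrightarrow>
      (t, b, b', False) \<in> P x \<longleftrightarrow> 0 \<le> (\<Sum>a\<in>A. x a * (v t a b - v t a b'))" for t b b' x
    by (simp add: P_def nonneg_indices_def I_def w_def)
  have thresh: "(t, b, b, True) \<in> P x \<longleftrightarrow> expected_utility A u x b \<le> y t"
    if "b \<in> Af" "t \<in> S" "x \<in> ?D" for t b x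
  proof -
    have "(\<Sum>a\<in>A. x a * (y t - u a b)) = (\<Sum>a\<in>A. x a) * y t - expected_utility A u x b"
      by (simp add: expected_utility_def right_diff_distrib sum_subtractf sum_distrib_right)
    then show ?thesis
      using that by (simp add: P_def nonneg_indices_def I_def w_def mixed_strategies_def)
  qed
  \<comment> \<open>The pattern fixes the optimal responses and thus the best response
    \<open>?b\<close>; membership of \<open>(t, ?b, ?b, True)\<close> then decides the threshold
    test. The assumptions are symmetric in \<open>x\<close> and \<open>x'\<close>, so this inclusion
    yields equality.\<close>
  have sub: "below x \<subseteq> below x'" if xx: "x \<in> ?D" "x' \<in> ?D" "P x = P x'" for x x'
  proof
    fix t assume t: "t \<in> below x"
    then have tS: "t \<in> S" by (simp add: below_def)
    let ?b = "best_response A Af r (v t) x"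
    have "optimal_responses A Af (v t) x = optimal_responses A Af (v t) x'"
      unfolding optimal_responses_conv using compare[OF _ _ tS] xx(3) by blast
    then have eq: "best_response A Af r (v t) x' = ?b"
      by (simp add: best_response_def)
    have b: "?b \<in> Af" using best_response_in_actions assms by blast
    show "t \<in> below x'"
      using t thresh[OF b tS xx(1)] thresh[OF b tS xx(2)] xx(3)
      by (simp add: below_def leader_payoff_def eq)
  qed
  have "Pow S \<subseteq> below ` ?D"
  proof
    fix T assume "T \<in> Pow S"
    then obtain x where "x \<in> ?D" "\<forall>s\<in>T. leader_payoff A Af r u v x s \<le> y s"
      "\<forall>s\<in>S - T. leader_payoff A Af r u v x s > y s"
      using y unfolding witnesses_shattering_def leader_payoffs_def by blast
    moreover from this have "below x = T"
      using \<open>T \<in> Pow S\<close> by (force simp: below_def)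
    ultimately show "T \<in> below ` ?D" by blast
  qed
  \<comment> \<open>Since \<open>below x\<close> depends only on \<open>P x\<close>, it can be
    computed from any representative of the pattern, here the one chosen by \<open>inv_into\<close>.
    Hence there are no more dichotomies than patterns.\<close>
  also have "below ` ?D \<subseteq> (\<lambda>p. below (inv_into ?D P p)) ` P ` ?D"
  proof
    fix T assume "T \<in> below ` ?D"
    then obtain x where x: "x \<in> ?D" "T = below x" by blast
    let ?x = "inv_into ?D P (P x)"
    have "P x \<in> P ` ?D" using x by blast
    then have "?x \<in> ?D" "P ?x = P x" by (rule inv_into_into, rule f_inv_into_f)
    then have "below ?x = below x" using sub x by (intro equalityI) auto
    then show "T \<in> (\<lambda>p. below (inv_into ?D P p)) ` P ` ?D" using x by force
  qed
  finally have "card (Pow S) \<le> card ((\<lambda>p. below (inv_into ?D P p)) ` P ` ?D)"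
    using finP by (intro card_mono) auto
  also have "\<dots> \<le> card (P ` ?D)"
    using finP by (rule card_image_le)
  also have "\<dots> \<le> (card I + 1) ^ card A"
    unfolding P_def using assms(1) finI by (rule card_halfspace_patterns)
  finally show ?thesis using assms(5) by (simp add: card_Pow cardI)
qed

section \<open>Solving for the number of types\<close>

text \<open>In terms of \<open>z = N / d\<close> and \<open>q = 4 * d * m^2\<close> the hypothesis
  implies \<open>z \<le> log 2 z + log 2 q\<close>. Since \<open>log 2 z \<le> 8 / 9 * z\<close>, a
  ninth of \<open>z\<close> remains on the left, which is the origin of the constant 9.\<close>

lemma solve_exponential_bound:
  fixes d m N :: nat
  assumes "0 < d" "0 < m" and le: "2 ^ N \<le> (2 * N * m\<^sup>2 + 1) ^ d"
  shows "real N \<le> 9 * real d * log 2 (4 * real d * (real m)\<^sup>2)"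
proof (cases "N = 0")
  case True
  have "1 \<le> real d * (real m)\<^sup>2"
    using assms by (metis One_nat_def Suc_leI mult_pos_pos of_nat_1 of_nat_le_iff of_nat_mult
        of_nat_power zero_less_power)
  then have "1 \<le> 4 * real d * (real m)\<^sup>2" by linarith
  then show ?thesis using True by simp
next
  case False
  define z where "z = real N / real d"
  define q where "q = 4 * real d * (real m)\<^sup>2"
  have z: "0 < z" and q: "0 < q" using False assms by (auto simp: z_def q_def)
  \<comment> \<open>As \<open>N\<close> and \<open>m\<close> are positive, the summand 1 is absorbed
    by a second \<open>2 * N * m^2\<close>; the total \<open>4 * N * m^2\<close> is exactly
    \<open>z * q\<close>.\<close>
  have "2 * N * m\<^sup>2 + 1 \<le> 4 * N * m\<^sup>2" using False assms by (simp add: Suc_le_eq)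
  then have "real (2 * N * m\<^sup>2 + 1) \<le> real (4 * N * m\<^sup>2)" by (rule of_nat_mono)
  also have "\<dots> = z * q" using assms by (simp add: z_def q_def)
  finally have zq: "real (2 * N * m\<^sup>2 + 1) \<le> z * q" .
  have "real (2 ^ N) \<le> real ((2 * N * m\<^sup>2 + 1) ^ d)" using le by (rule of_nat_mono)
  then have "2 ^ N \<le> real (2 * N * m\<^sup>2 + 1) ^ d" by simp
  also have "\<dots> \<le> (z * q) ^ d" using zq by (intro power_mono) auto
  finally have "log 2 (2 ^ N) \<le> log 2 ((z * q) ^ d)" using z q by (subst log_le_cancel_iff) auto
  then have "real N \<le> real d * log 2 (z * q)" using z q by (simp add: log_nat_power)
  then have "z \<le> log 2 (z * q)" using assms by (simp add: z_def field_simps)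
  then have 1: "z \<le> log 2 z + log 2 q" using z q by (simp add: log_mult)
  \<comment> \<open>The bound \<open>ln x \<le> x - 1\<close> at 1/2 gives only
    \<open>1 / 2 \<le> ln 2\<close>; applied to the factors 3/4 and 2/3 it gives 7/12. The value
    9/16 is chosen so that \<open>8 / 9 * ln 2\<close> is at least 1/2.\<close>
  have "ln (1 / 2 :: real) = ln (3 / 4) + ln (2 / 3)"
    using ln_mult[of "3 / 4 :: real" "2 / 3"] by simp
  also have "\<dots> \<le> (3 / 4 - 1) + (2 / 3 - 1)" by (intro add_mono ln_le_minus_one) auto
  finally have ln2: "9 / 16 \<le> ln (2 :: real)" by (simp add: ln_div)
  \<comment> \<open>This is the tangent bound at 2, with \<open>ln 2\<close> rounded up to 1 so that
    the constants cancel and \<open>z / 2\<close> remains.\<close>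
  have "ln z = ln (z / 2) + ln 2" using z by (simp add: ln_div)
  also have "\<dots> \<le> (z / 2 - 1) + 1"
    using z ln_2_less_1 by (intro add_mono ln_le_minus_one) auto
  also have "\<dots> \<le> 8 / 9 * z * ln 2"
    using mult_left_mono[OF ln2, of z] z by simp
  finally have "log 2 z \<le> 8 / 9 * z" by (simp add: log_def divide_le_eq)
  then have "z \<le> 9 * log 2 q" using 1 by simp
  then show ?thesis using assms by (simp add: z_def q_def divide_le_eq mult_ac)
qed

theorem theoremC8:
  fixes A :: "'a set" and Af :: "'b set" and r :: "'b rel" and K :: nat
    and u :: "'a \<Rightarrow> 'b \<Rightarrow> real" and uf :: "nat \<Rightarrow> 'a \<Rightarrow> 'b \<Rightarrow> real"
  assumes "finite A" and "A \<noteq> {}"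
    and "finite Af" and "Af \<noteq> {}"
    and "linear_order_on Af r"
    and "\<And>a b. a \<in> A \<Longrightarrow> b \<in> Af \<Longrightarrow> u a b \<in> {0..1}"
    and "\<And>f a b. f \<in> {1..K} \<Longrightarrow> a \<in> A \<Longrightarrow> b \<in> Af \<Longrightarrow> uf f a b \<in> {0..1}"
  shows "ereal_of_enat (pdim {1..K} (leader_payoffs A Af r u uf))
           \<le> ereal (9 * real (card A) * log 2 (4 * real (card A) * (real (card Af))\<^sup>2))"
proof -
  define B where "B = 9 * real (card A) * log 2 (4 * real (card A) * (real (card Af))\<^sup>2)"
  have pos: "0 < card A" "0 < card Af" using assms by (auto simp: card_gt_0_iff)
  have bound: "real (card S) \<le> B" if "finite S" "shattered (leader_payoffs A Af r u uf) S" for S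
    unfolding B_def using pos two_power_card_shattered_le[OF assms(1,3-5) that]
    by (rule solve_exponential_bound)
  \<comment> \<open>The supremum is taken in \<open>enat\<close>, so \<open>B\<close> is rounded
    down to a natural number, which loses nothing for cardinalities. Nonnegativity ensures that
    \<open>nat\<close> does not replace a negative floor by 0 and thereby exceed
    \<open>B\<close>.\<close>
  have "0 \<le> B" unfolding B_def using solve_exponential_bound[OF pos, of 0] by simp
  have "pdim {1..K} (leader_payoffs A Af r u uf) \<le> enat (nat \<lfloor>B\<rfloor>)"
    unfolding pdim_def using bound by (intro SUP_least) (auto simp: le_nat_floor)
  then have "ereal_of_enat (pdim {1..K} (leader_payoffs A Af r u uf))
      \<le> ereal_of_enat (enat (nat \<lfloor>B\<rfloor>))"
    by (simp only: ereal_of_enat_le_iff)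
  also have "\<dots> \<le> ereal B" using \<open>0 \<le> B\<close> by simp
  finally show ?thesis by (simp only: B_def)
qed

end
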